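(* Let $q$ be a prime power, $n\ge1$, and let $M$ be chosen uniformly at random from $\mathrm{SL}(n,\mathbb{F}_q)$. Then for every integer $0\le h<n$ and every monic $f\in\mathbb{F}_q[T]$ of degree $n$, $$\left|\mathbb{P}_{M\in\mathrm{SL}(n,\mathbb{F}_q)}\big(\det(T-M)\in I(f;h)\big)-\frac{q^{h+1}}{q^n}\right|\le\frac{(q-1)(n-h)}{q^n}.$$
   Context: $\mathrm{SL}(n,\mathbb{F}_q)$ is the group of $n\times n$ matrices over $\mathbb{F}_q$ of determinant $1$, with uniform probability measure. For a monic $f$ of degree $n$ and $0\le h\le n-1$, $I(f;h)=\{g\in\mathbb{F}_q[T]\text{ monic}:\deg(f-g)\le h\}$ (with $\deg0=-\infty$). *)

theory Defs
  imports "Jordan_Normal_Form.Char_Poly"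
begin

definition SL_mat :: "nat \<Rightarrow> 'a :: field mat set" where
  "SL_mat n = {M \<in> carrier_mat n n. det M = 1}"

text \<open>I(f;h): monic g with deg(f - g) \<le> h (deg 0 = -infinity, so f - g = 0 is allowed).\<close>
definition I_int :: "'a :: field poly \<Rightarrow> nat \<Rightarrow> 'a poly set" where
  "I_int f h = {g. monic g \<and> (f - g = 0 \<or> degree (f - g) \<le> h)}"

definition prob_SL_charpoly :: "nat \<Rightarrow> 'a :: {finite,field} poly \<Rightarrow> nat \<Rightarrow> real" where
  "prob_SL_charpoly n f h =
     real (card {M \<in> SL_mat n. char_poly M \<in> I_int f h}) / real (card (SL_mat n :: 'a mat set))"

end

theory Submission
  imports Defs "HOL-Library.Cardinality"
begin

text \<open>
  Let \<open>\<gamma> m = |GL m|\<close>. A pair \<open>(M, v)\<close> of an \<open>n \<times> n\<close> matrix and a vector splits \<open>M\<close> along the cyclic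
  subspace generated by \<open>v\<close>, of dimension \<open>k = n - m\<close> say, into the companion matrix of a monic
  \<open>e\<close> of degree \<open>k\<close> and an \<open>m \<times> m\<close> quotient \<open>D\<close>, with \<open>char_poly M = e * char_poly D\<close>. Counting
  bases adapted to this splitting gives, for every set \<open>J\<close> of polynomials,
  \<open>q ^ n |{M. char_poly M \<in> J}| = (\<Sum>m\<le>n. \<gamma> n / \<gamma> m * (\<Sum>D. |{e. e * char_poly D \<in> J}|))\<close>.
  Take for \<open>J\<close> the members of \<open>I(f;h)\<close> with constant coefficient \<open>(-1) ^ n\<close>. Only invertible \<open>D\<close>
  contribute, and the number of admissible \<open>e\<close> is exactly \<open>q ^ (h - m)\<close> if \<open>m \<le> h\<close> and at
  most \<open>1\<close> otherwise. The terms with \<open>m \<le> h\<close> add up to \<open>(q ^ (h + 1) - 1) / (q - 1)\<close>, and the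
  remaining \<open>n - h\<close> terms account for the error.
\<close>

section \<open>Matrices over a finite field\<close>

definition GL_mat :: "nat \<Rightarrow> 'a :: field mat set" where
  "GL_mat n = {P \<in> carrier_mat n n. det P \<noteq> 0}"

lemma GL_mat_obtain_inverse:
  assumes "P \<in> GL_mat n"
  obtains Q where "Q \<in> GL_mat n" "P * Q = 1\<^sub>m n" "Q * P = 1\<^sub>m n"
proof -
  have P: "P \<in> carrier_mat n n" "det P \<noteq> 0" using assms by (auto simp: GL_mat_def)
  from det_non_zero_imp_unit[OF this, unfolded Units_def ring_mat_def]
  obtain Q where Q: "Q \<in> carrier_mat n n" "Q * P = 1\<^sub>m n" "P * Q = 1\<^sub>m n" by auto
  have "det Q * det P = 1" using det_mult[OF Q(1) P(1)] Q(2) by simp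
  hence "det Q \<noteq> 0" by auto
  thus ?thesis using that Q by (auto simp: GL_mat_def)
qed

lemma GL_mat_mult: "P \<in> GL_mat n \<Longrightarrow> Q \<in> GL_mat n \<Longrightarrow> P * Q \<in> GL_mat n"
  by (auto simp: GL_mat_def det_mult)

lemma one_GL_mat: "1\<^sub>m n \<in> GL_mat n"
  by (auto simp: GL_mat_def)

lemma card_carrier_mat:
  "card (carrier_mat r c :: 'a :: finite mat set) = CARD('a) ^ (r * c)"
  "finite (carrier_mat r c :: 'a :: finite mat set)"
proof -
  let ?I = "{..<r} \<times> {..<c}"
  have b: "bij_betw (\<lambda>F. mat r c F) (?I \<rightarrow>\<^sub>E (UNIV :: 'a set)) (carrier_mat r c)"
  proof (rule bij_betw_byWitness[where f' = "\<lambda>M. restrict (\<lambda>p. M $$ p) ?I"])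
    show "\<forall>F\<in>?I \<rightarrow>\<^sub>E (UNIV :: 'a set). restrict (\<lambda>p. mat r c F $$ p) ?I = F"
      by (intro ballI extensionalityI[of _ ?I]) (auto simp: PiE_def)
    show "\<forall>M\<in>carrier_mat r c. mat r c (restrict (\<lambda>p. M $$ p) ?I) = (M :: 'a mat)"
      by (auto intro!: eq_matI)
  qed (auto split: if_splits)
  have "card (?I \<rightarrow>\<^sub>E (UNIV :: 'a set)) = CARD('a) ^ (r * c)"
    by (simp add: card_PiE)
  thus "card (carrier_mat r c :: 'a mat set) = CARD('a) ^ (r * c)"
    using bij_betw_same_card[OF b] by simp
  have "finite (?I \<rightarrow>\<^sub>E (UNIV :: 'a set))" by (intro finite_PiE) auto
  thus "finite (carrier_mat r c :: 'a mat set)" using bij_betw_finite[OF b] by simp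
qed

lemma card_carrier_vec:
  "card (carrier_vec n :: 'a :: finite vec set) = CARD('a) ^ n"
  "finite (carrier_vec n :: 'a :: finite vec set)"
proof -
  have b: "bij_betw (\<lambda>F. vec n F) ({..<n} \<rightarrow>\<^sub>E (UNIV :: 'a set)) (carrier_vec n)"
  proof (rule bij_betw_byWitness[where f' = "\<lambda>v. restrict (\<lambda>i. v $ i) {..<n}"])
    show "\<forall>F\<in>{..<n} \<rightarrow>\<^sub>E (UNIV :: 'a set). restrict (\<lambda>i. vec n F $ i) {..<n} = F"
      by (auto simp: fun_eq_iff PiE_def extensional_def restrict_def)
    show "(\<lambda>v. restrict (\<lambda>i. v $ i) {..<n}) ` carrier_vec n \<subseteq> {..<n} \<rightarrow>\<^sub>E (UNIV :: 'a set)"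
      by (simp add: image_subset_iff)
    show "\<forall>v\<in>carrier_vec n. vec n (restrict (\<lambda>i. v $ i) {..<n}) = (v :: 'a vec)"
      by (intro ballI eq_vecI) auto
    show "vec n ` ({..<n} \<rightarrow>\<^sub>E UNIV) \<subseteq> carrier_vec n" by (rule image_subsetI) (rule vec_carrier)
  qed
  have "card ({..<n} \<rightarrow>\<^sub>E (UNIV :: 'a set)) = CARD('a) ^ n"
    by (simp add: card_PiE)
  thus "card (carrier_vec n :: 'a vec set) = CARD('a) ^ n"
    using bij_betw_same_card[OF b] by simp
  have "finite ({..<n} \<rightarrow>\<^sub>E (UNIV :: 'a set))" by (intro finite_PiE) auto
  thus "finite (carrier_vec n :: 'a vec set)" using bij_betw_finite[OF b] by simp
qed

lemma finite_GL_mat: "finite (GL_mat n :: 'a :: {finite, field} mat set)"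
  by (rule finite_subset[OF _ card_carrier_mat(2)[of n n]]) (auto simp: GL_mat_def)

lemma card_GL_mat_pos: "card (GL_mat n :: 'a :: {finite, field} mat set) > 0"
  using one_GL_mat[of n] finite_GL_mat[of n] card_gt_0_iff by blast

text \<open>Scaling row 0 by c multiplies the determinant by c, so an invertible matrix is
  determined by its determinant together with a matrix of determinant 1. The hypothesis n >= 1
  supplies the row to be scaled.\<close>

lemma card_GL_mat_SL_mat:
  assumes "n \<ge> 1"
  shows "card (GL_mat n :: 'a :: {finite, field} mat set) =
    (CARD('a) - 1) * card (SL_mat n :: 'a mat set)"
proof -
  let ?f = "\<lambda>(c :: 'a, M :: 'a mat). multrow 0 c M"
  let ?g = "\<lambda>A :: 'a mat. (det A, multrow 0 (inverse (det A)) A)"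
  have d: "det (multrow 0 c A) = c * det A" if "A \<in> carrier_mat n n" for c and A :: "'a mat"
    using det_multrow[of 0 n A c] that assms by auto
  have "bij_betw ?f ((UNIV - {0}) \<times> SL_mat n) (GL_mat n)"
  proof (rule bij_betw_byWitness[where f' = ?g])
    show "\<forall>x\<in>(UNIV - {0}) \<times> SL_mat n. ?g (?f x) = x"
      by (auto simp: SL_mat_def d intro!: eq_matI)
    show "\<forall>A\<in>GL_mat n. ?f (?g A) = A"
      by (auto simp: GL_mat_def intro!: eq_matI)
    show "?f ` ((UNIV - {0}) \<times> SL_mat n) \<subseteq> GL_mat n"
      by (auto simp: SL_mat_def GL_mat_def d)
    show "?g ` GL_mat n \<subseteq> (UNIV - {0}) \<times> SL_mat n"
      by (auto simp: SL_mat_def GL_mat_def d)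
  qed
  from bij_betw_same_card[OF this] show ?thesis
    by (simp add: card_cartesian_product card_Diff_singleton)
qed

text \<open>Evaluate det(T - A) at T = 0. This makes the determinant visible in the characteristic
  polynomial: determinant 1 becomes constant coefficient (-1)^n, and singularity becomes constant
  coefficient 0.\<close>

lemma coeff_0_char_poly:
  assumes "A \<in> carrier_mat n n"
  shows "coeff (char_poly (A :: 'a :: field mat)) 0 = (-1) ^ n * det A"
proof -
  have "- char_matrix A 0 = (-1) \<cdot>\<^sub>m A"
    using assms by (intro eq_matI) (auto simp: char_matrix_def)
  hence "poly (char_poly A) 0 = det ((-1) \<cdot>\<^sub>m A)"
    using char_poly_matrix[OF assms, of 0] by metis
  also have "\<dots> = (-1) ^ n * det A"
    using assms det_smult[of "-1" A] by auto
  finally show ?thesis by (metis poly_0_coeff_0)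
qed

lemma char_poly_four_block_lower_left_zero:
  fixes A :: "'a :: idom mat"
  assumes A: "A \<in> carrier_mat n n" and B: "B \<in> carrier_mat n m" and D: "D \<in> carrier_mat m m"
  shows "char_poly (four_block_mat A B (0\<^sub>m m n) D) = char_poly A * char_poly D"
proof -
  have "char_poly_matrix (four_block_mat A B (0\<^sub>m m n) D) =
    four_block_mat (char_poly_matrix A) (map_mat (\<lambda>a. [:- a:]) B) (0\<^sub>m m n) (char_poly_matrix D)"
    using assms by (intro eq_matI) (auto simp: char_poly_matrix_def)
  thus ?thesis unfolding char_poly_def
    using det_four_block_mat_lower_left_zero[of "char_poly_matrix A" n
        "map_mat (\<lambda>a. [:- a:]) B" m "0\<^sub>m m n" "char_poly_matrix D"] assms by simp
qed

section \<open>Companion matrices\<close>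

definition companion_mat :: "'a :: comm_ring_1 poly \<Rightarrow> 'a mat" where
  "companion_mat e = mat (degree e) (degree e)
     (\<lambda>(i, j). if Suc j = degree e then - coeff e i else if i = Suc j then 1 else 0)"

lemma companion_mat_carrier [simp]: "companion_mat e \<in> carrier_mat (degree e) (degree e)"
  by (simp add: companion_mat_def)

text \<open>Induction on the coefficient list. In the first row of T - C only columns 0 and k can be
  nonzero, with entries T and a when k > 0. Laplace expansion along it gives T * e + a, because
  deleting row and column 0 leaves the characteristic matrix of the smaller companion
  matrix.\<close>

lemma char_poly_companion_mat:
  assumes "monic (e :: 'a :: field poly)"
  shows "char_poly (companion_mat e) = e"
  using assms
proof (induction e)
  case (pCons a e)
  show ?case
  proof (cases "e = 0")
    case True
    thus ?thesis using pCons.prems by (simp add: companion_mat_def char_poly_def char_poly_matrix_def one_pCons)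
  next
    case False
    define k where "k = degree e"
    define M where "M = char_poly_matrix (companion_mat (pCons a e))"
    have e: "monic e" using pCons.prems False by simp
    have deg: "degree (pCons a e) = Suc k" using False by (simp add: k_def)
    have M: "M \<in> carrier_mat (Suc k) (Suc k)"
      unfolding M_def by (rule char_poly_matrix_closed) (metis companion_mat_carrier deg)
    have Mij: "M $$ (i, j) = (if i = j then [:0, 1:] else 0) +
        (if j = k then [:coeff (pCons a e) i:] else if i = Suc j then -1 else 0)"
      if "i < Suc k" "j < Suc k" for i j
      using that False unfolding M_def char_poly_matrix_def companion_mat_def
      by (auto simp: one_pCons k_def)
    \<comment> \<open>For k = 0 the two columns 0 and k coincide and the matrix has the single entry
      T + a, so this case is separated.\<close>
    show ?thesis
    proof (cases "k = 0")
      case True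
      have "e = 1" using monic_degree_0[OF e] True by (simp add: k_def)
      hence "M $$ (0, 0) = pCons a e" using True Mij[of 0 0] by (simp add: one_pCons)
      moreover have "char_poly (companion_mat (pCons a e)) = M $$ (0, 0)"
        unfolding char_poly_def M_def[symmetric] using M True by (simp add: det_single)
      ultimately show ?thesis by simp
    next
      case k: False
      have d0: "mat_delete M 0 0 = char_poly_matrix (companion_mat e)"
        using k by (intro eq_matI) (use M in \<open>auto simp: mat_delete_def Mij char_poly_matrix_def
          companion_mat_def k_def one_pCons coeff_pCons split: nat.splits\<close>)
      \<comment> \<open>Without row 0 and the last column, the entries -1 move onto the diagonal and
        the matrix is upper triangular. Its determinant (-1)^k cancels the sign of the
        cofactor.\<close>
      have dk: "mat_delete M 0 k = mat k k (\<lambda>(i, j). if i = j then -1 else if Suc i = j then [:0,1:] else 0)"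
        using k by (intro eq_matI) (use M in \<open>auto simp: mat_delete_def Mij\<close>)
      have "det (mat_delete M 0 k) = (\<Prod>i = 0..<k. mat_delete M 0 k $$ (i, i))"
        unfolding dk by (subst det_upper_triangular[where n = k]) (auto simp: upper_triangular_def diag_mat_def prod.list_conv_set_nth)
      also have "\<dots> = (-1) ^ k" unfolding dk by simp
      finally have detk: "det (mat_delete M 0 k) = (-1) ^ k" .
      have "det M = (\<Sum>j<Suc k. M $$ (0, j) * cofactor M 0 j)"
        by (rule laplace_expansion_row[OF M]) simp
      also have "\<dots> = (\<Sum>j\<in>{0, k}. M $$ (0, j) * cofactor M 0 j)"
        by (rule sum.mono_neutral_right) (auto simp: Mij)
      also have "\<dots> = [:0, 1:] * det (mat_delete M 0 0) + [:a:] * ((-1) ^ k * det (mat_delete M 0 k))"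
        using k by (simp add: Mij cofactor_def)
      also have "\<dots> = pCons a e"
        unfolding d0 detk using pCons.IH[OF e] by (simp add: char_poly_def flip: power_mult_distrib)
      finally show ?thesis by (simp add: char_poly_def M_def)
    qed
  qed
qed simp

section \<open>Polynomials in short intervals\<close>

text \<open>Vanishing coefficients, rather than a degree bound, describe the polynomials of degree
  less than t uniformly: t = 0 leaves only the zero polynomial.\<close>

lemma card_poly_coeffs_vanish_from:
  "finite {p :: 'a :: {finite, zero} poly. \<forall>i\<ge>t. coeff p i = 0}"
  "card {p :: 'a poly. \<forall>i\<ge>t. coeff p i = 0} = CARD('a) ^ t"
proof (induction t)
  case 0
  have "{p :: 'a poly. \<forall>i\<ge>0. coeff p i = 0} = {0}" by (auto simp: poly_eq_iff)
  thus "finite {p :: 'a poly. \<forall>i\<ge>0. coeff p i = 0}"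
    "card {p :: 'a poly. \<forall>i\<ge>0. coeff p i = 0} = CARD('a) ^ 0" by simp_all
next
  case (Suc t)
  let ?S = "\<lambda>t. {p :: 'a poly. \<forall>i\<ge>t. coeff p i = 0}"
  have *: "?S (Suc t) = (\<lambda>(a, p). pCons a p) ` (UNIV \<times> ?S t)"
  proof (intro equalityI subsetI)
    fix p assume p: "p \<in> ?S (Suc t)"
    obtain a r where ar: "p = pCons a r" by (cases p)
    have "coeff r i = 0" if "i \<ge> t" for i
    proof -
      have "coeff p (Suc i) = 0" using p that by simp
      thus ?thesis by (simp add: ar)
    qed
    thus "p \<in> (\<lambda>(a, p). pCons a p) ` (UNIV \<times> ?S t)"
      by (intro rev_image_eqI[of "(a, r)"]) (auto simp: ar)
  qed (auto simp: coeff_pCons split: nat.splits)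
  have inj: "inj_on (\<lambda>(a, p). pCons a p) (UNIV \<times> ?S t)" by (auto simp: inj_on_def)
  show "finite (?S (Suc t))" unfolding * using Suc.IH(1) by simp
  show "card (?S (Suc t)) = CARD('a) ^ Suc t"
    unfolding * card_image[OF inj] using Suc.IH(2) by (simp add: card_cartesian_product)
qed

lemma card_poly_degree_le_coeff_0:
  "card {p :: 'a :: {finite, zero} poly. degree p \<le> t \<and> coeff p 0 = a} = CARD('a) ^ t"
proof -
  have "{p :: 'a poly. degree p \<le> t \<and> coeff p 0 = a} = pCons a ` {p. \<forall>i\<ge>t. coeff p i = 0}"
  proof (intro equalityI subsetI)
    fix p :: "'a poly" assume p: "p \<in> {p. degree p \<le> t \<and> coeff p 0 = a}"
    obtain b r where br: "p = pCons b r" by (cases p)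
    have "coeff r i = 0" if "i \<ge> t" for i
    proof -
      have "coeff p (Suc i) = 0" using p that by (intro coeff_eq_0) auto
      thus ?thesis by (simp add: br)
    qed
    thus "p \<in> pCons a ` {p. \<forall>i\<ge>t. coeff p i = 0}" using p br by auto
  next
    fix p assume "p \<in> pCons a ` {p. \<forall>i\<ge>t. coeff p i = 0}"
    thus "p \<in> {p. degree p \<le> t \<and> coeff p 0 = a}"
      by (auto intro!: degree_le simp: coeff_pCons split: nat.splits)
  qed
  moreover have "inj_on (pCons a) {p. \<forall>i\<ge>t. coeff p i = 0}" by (auto simp: inj_on_def)
  ultimately show ?thesis using card_poly_coeffs_vanish_from(2)[of t, where ?'a = 'a] by (simp add: card_image)
qed

lemma finite_poly_degree_eq: "finite {p :: 'a :: {finite, zero} poly. degree p = k}"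
  by (rule finite_subset[OF _ card_poly_coeffs_vanish_from(1)[of "Suc k"]])
    (auto intro: coeff_eq_0)

text \<open>Since h < deg f, a polynomial g this close to f shares its leading term, so monicity
  comes for free. The case f - g = 0 is absorbed by the convention
  \<open>degree 0 = 0\<close>.\<close>

lemma mem_I_int_iff:
  assumes "monic f" "h < degree f"
  shows "g \<in> I_int f h \<longleftrightarrow> degree (f - g) \<le> h"
    and "g \<in> I_int f h \<Longrightarrow> degree g = degree f"
proof -
  have *: "monic g \<and> degree g = degree f" if "degree (f - g) \<le> h"
  proof -
    have lt: "degree (- (f - g)) < degree f" using that assms(2) unfolding degree_minus by simp
    have g: "g = f + - (f - g)" by simp
    have "degree g = degree f" by (subst g, rule degree_add_eq_left[OF lt])
    moreover have "coeff (f - g) (degree f) = 0" using that assms(2) by (intro coeff_eq_0) simp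
    ultimately show ?thesis using assms(1) by simp
  qed
  show "g \<in> I_int f h \<longleftrightarrow> degree (f - g) \<le> h" using * by (auto simp: I_int_def)
  thus "g \<in> I_int f h \<Longrightarrow> degree g = degree f" using * by blast
qed

text \<open>Closeness of e * d to f already forces e * d to be monic of degree deg f, hence e to be
  monic of the complementary degree. What remains are the two conditions that are easy to
  count.\<close>

lemma cofactor_conditions:
  fixes d f :: "'a :: field poly"
  assumes d: "monic d" and f: "monic f" "h < degree f"
  shows "{e. monic e \<and> degree e = degree f - degree d \<and> e * d \<in> {g \<in> I_int f h. coeff g 0 = c}} =
    {e. degree (f - e * d) \<le> h \<and> coeff e 0 * coeff d 0 = c}" (is "?L = ?R")
proof (intro equalityI subsetI)
  fix e assume "e \<in> ?L"
  thus "e \<in> ?R" using mem_I_int_iff(1)[OF f] by (auto simp: coeff_mult_0)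
next
  fix e assume e: "e \<in> ?R"
  hence I: "e * d \<in> I_int f h" using mem_I_int_iff(1)[OF f] by auto
  hence "monic (e * d)" by (simp add: I_int_def)
  hence "monic e" using d by (simp add: lead_coeff_mult)
  moreover from this have "degree (e * d) = degree e + degree d"
    using d by (intro degree_mult_eq) auto
  ultimately show "e \<in> ?L" using e I mem_I_int_iff(2)[OF f I] by (auto simp: coeff_mult_0)
qed

text \<open>Divide f by d with quotient Q. The remainder has degree at most h, so e = Q + s is
  admissible for the degree bound iff deg s <= h - deg d. As d(0) is nonzero, the condition at 0
  fixes the constant coefficient of s and leaves h - deg d free coefficients.\<close>

lemma card_cofactors_eq:
  fixes d f :: "'a :: {finite, field} poly"
  assumes d: "monic d" "coeff d 0 \<noteq> 0" "degree d \<le> h" and f: "monic f" "h < degree f"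
  shows "card {e. monic e \<and> degree e = degree f - degree d \<and> e * d \<in> {g \<in> I_int f h. coeff g 0 = c}} =
    CARD('a) ^ (h - degree d)"
proof -
  define Q where "Q = f div d"
  have d0: "d \<noteq> 0" using d by auto
  have R: "degree (f mod d) \<le> h" using degree_mod_less'[OF d0, of f] d(3) by (cases "f mod d = 0") auto
  have key: "degree (f - (Q + s) * d) \<le> h \<longleftrightarrow> degree s \<le> h - degree d" for s
  proof -
    have "f - Q * d = f mod d" unfolding Q_def by (simp add: minus_div_mult_eq_mod)
    hence eq: "f - (Q + s) * d = f mod d - s * d" by (simp add: algebra_simps)
    have "degree (f mod d - s * d) \<le> h \<longleftrightarrow> degree (s * d) \<le> h"
      using degree_diff_le[OF R, of "s * d"] degree_diff_le[OF R, of "f mod d - s * d"] by auto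
    also have "\<dots> \<longleftrightarrow> degree s \<le> h - degree d"
      using d(3) d0 by (cases "s = 0") (auto simp: degree_mult_eq)
    finally show ?thesis unfolding eq .
  qed
  let ?S = "{s. degree s \<le> h - degree d \<and> coeff s 0 = c / coeff d 0 - coeff Q 0}"
  have "{e. degree (f - e * d) \<le> h \<and> coeff e 0 * coeff d 0 = c} = (+) Q ` ?S"
  proof (intro equalityI subsetI)
    fix e assume e: "e \<in> {e. degree (f - e * d) \<le> h \<and> coeff e 0 * coeff d 0 = c}"
    have "e - Q \<in> ?S" using e key[of "e - Q"] d(2) by (auto simp: field_simps)
    thus "e \<in> (+) Q ` ?S" by (rule rev_image_eqI) simp
  next
    fix e assume "e \<in> (+) Q ` ?S"
    then obtain s where s: "s \<in> ?S" "e = Q + s" by auto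
    thus "e \<in> {e. degree (f - e * d) \<le> h \<and> coeff e 0 * coeff d 0 = c}"
      using key[of s] d(2) by (simp add: field_simps)
  qed
  thus ?thesis unfolding cofactor_conditions[OF d(1) f]
    by (simp add: card_image card_poly_degree_le_coeff_0)
qed

text \<open>For two solutions x and y, the product (y - x) * d has degree at most h < deg d, which
  forces x = y.\<close>

lemma card_cofactors_le_1:
  fixes d f :: "'a :: field poly"
  assumes d: "monic d" "h < degree d" and f: "monic f" "h < degree f"
  shows "card {e. monic e \<and> degree e = degree f - degree d \<and> e * d \<in> {g \<in> I_int f h. coeff g 0 = c}} \<le> 1"
proof -
  let ?S = "{e. degree (f - e * d) \<le> h \<and> coeff e 0 * coeff d 0 = c}"
  have "x = y" if "x \<in> ?S" "y \<in> ?S" for x y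
  proof (rule ccontr)
    assume "x \<noteq> y"
    hence "degree ((y - x) * d) = degree (y - x) + degree d" using d by (intro degree_mult_eq) auto
    moreover have "(y - x) * d = (f - x * d) - (f - y * d)" by (simp add: algebra_simps)
    hence "degree ((y - x) * d) \<le> h" using that degree_diff_le[of "f - x * d" h "f - y * d"] by simp
    ultimately show False using d(2) by simp
  qed
  \<comment> \<open>The field may be infinite here, so finiteness is drawn from the uniqueness just
    shown.\<close>
  moreover from this have "finite ?S" by (metis (mono_tags, lifting) finite.simps finite_subset insertI1 subsetI)
  ultimately show ?thesis unfolding cofactor_conditions[OF d(1) f]
    by (auto simp: card_le_Suc0_iff_eq)
qed

section \<open>Krylov bases\<close>

text \<open>Nonemptiness encodes linear independence of v, M v, ..., M^(k-1) v, and the members are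
  the bases extending this sequence, which get counted later. The conjunct \<open>k \<le> n\<close>
  rules out columns past the last one, where \<open>col P j\<close> carries no information.\<close>

definition krylov_bases :: "nat \<Rightarrow> 'a :: field mat \<Rightarrow> 'a vec \<Rightarrow> nat \<Rightarrow> 'a mat set" where
  "krylov_bases n M v k = {P \<in> GL_mat n. k \<le> n \<and> (\<forall>j<k. col P j = M ^\<^sub>m j *\<^sub>v v)}"

lemma mult_mat_unit_vec:
  assumes "(A :: 'a :: semiring_1 mat) \<in> carrier_mat m n" "j < n"
  shows "A *\<^sub>v unit_vec n j = col A j"
  using assms col_mult2[of A m n "1\<^sub>m n" n j] by simp

text \<open>The recursion of \<open>pow_mat\<close> adds the new factor on the right; Krylov
  sequences need it on the left.\<close>

lemma Suc_pow_mat_mult_vec: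
  assumes "(A :: 'a :: semiring_1 mat) \<in> carrier_mat n n" "u \<in> carrier_vec n"
  shows "A ^\<^sub>m Suc k *\<^sub>v u = A *\<^sub>v (A ^\<^sub>m k *\<^sub>v u)"
  using assms(2)
proof (induction k arbitrary: u)
  case 0
  thus ?case using assms(1) by simp
next
  case (Suc k)
  have Au: "A *\<^sub>v u \<in> carrier_vec n" using assms(1) Suc.prems by simp
  have split: "A ^\<^sub>m Suc j *\<^sub>v u = A ^\<^sub>m j *\<^sub>v (A *\<^sub>v u)" for j
    using assms(1) Suc.prems unfolding pow_mat.simps
    by (intro assoc_mult_mat_vec[of _ n n _ n]) auto
  show ?case using Suc.IH[OF Au] split by metis
qed

text \<open>With Q inverse to P, (P A Q)^j (P u) = P (A^j u), so P carries the Krylov sequence of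
  (A, u) to that of the conjugated pair.\<close>

lemma krylov_bases_conj:
  assumes A: "A \<in> carrier_mat n n" and u: "u \<in> carrier_vec n"
    and P: "P \<in> GL_mat n" and Q: "Q \<in> GL_mat n" and PQ: "P * Q = 1\<^sub>m n" and QP: "Q * P = 1\<^sub>m n"
    and R: "R \<in> carrier_mat n n"
  shows "R \<in> krylov_bases n (P * A * Q) (P *\<^sub>v u) k \<longleftrightarrow> Q * R \<in> krylov_bases n A u k"
proof -
  have Pc: "P \<in> carrier_mat n n" and Qc: "Q \<in> carrier_mat n n" and dQ: "det Q \<noteq> 0"
    using P Q by (auto simp: GL_mat_def)
  have cancel: "P *\<^sub>v (Q *\<^sub>v x) = x" "Q *\<^sub>v (P *\<^sub>v x) = x" if "x \<in> carrier_vec n" for x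
    using assoc_mult_mat_vec[OF Pc Qc that] assoc_mult_mat_vec[OF Qc Pc that] PQ QP that by auto
  have "similar_mat_wit (P * A * Q) A P Q"
    using A Pc Qc PQ QP unfolding similar_mat_wit_def Let_def by auto
  from similar_mat_wit_pow_id[OF this]
  have pow: "(P * A * Q) ^\<^sub>m j = P * A ^\<^sub>m j * Q" for j .
  have powu: "(P * A * Q) ^\<^sub>m j *\<^sub>v (P *\<^sub>v u) = P *\<^sub>v (A ^\<^sub>m j *\<^sub>v u)" for j
  proof -
    have Aj: "A ^\<^sub>m j \<in> carrier_mat n n" using A by simp
    have "(P * A ^\<^sub>m j * Q) *\<^sub>v (P *\<^sub>v u) = (P * A ^\<^sub>m j) *\<^sub>v (Q *\<^sub>v (P *\<^sub>v u))"
      using Aj Pc Qc u by (intro assoc_mult_mat_vec[of _ n n _ n]) auto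
    also have "\<dots> = (P * A ^\<^sub>m j) *\<^sub>v u" using cancel(2)[OF u] by simp
    also have "\<dots> = P *\<^sub>v (A ^\<^sub>m j *\<^sub>v u)" using Aj Pc u by (intro assoc_mult_mat_vec[of _ n n _ n]) auto
    finally show ?thesis unfolding pow .
  qed
  have "col R j = P *\<^sub>v (A ^\<^sub>m j *\<^sub>v u) \<longleftrightarrow> col (Q * R) j = A ^\<^sub>m j *\<^sub>v u" if "j < n" for j
  proof -
    have Aju: "A ^\<^sub>m j *\<^sub>v u \<in> carrier_vec n" using A u by (intro mult_mat_vec_carrier[of _ n n]) auto
    have Rj: "col R j \<in> carrier_vec n" using R that by auto
    have "col (Q * R) j = Q *\<^sub>v col R j" by (rule col_mult2[OF Qc R that])
    thus ?thesis using cancel(1)[OF Rj] cancel(2)[OF Aju] by auto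
  qed
  moreover have "Q * R \<in> GL_mat n \<longleftrightarrow> R \<in> GL_mat n"
    using R Qc dQ by (auto simp: GL_mat_def det_mult)
  ultimately show ?thesis unfolding krylov_bases_def powu by (auto simp: less_le_trans)
qed

text \<open>Replace column i of the identity by w, which gives determinant w_i by Cramer's rule, and
  then swap columns k and i. The columns before k are untouched because k <= i.\<close>

lemma GL_mat_with_prescribed_column:
  assumes w: "w \<in> carrier_vec n" "w $ i \<noteq> 0" and ki: "k \<le> i" "i < n"
  obtains R where "R \<in> GL_mat n" "\<And>j. j < k \<Longrightarrow> col R j = unit_vec n j" "col R k = (w :: 'a :: field vec)"
proof -
  define S where "S = replace_col (1\<^sub>m n) w i"
  have S: "S \<in> carrier_mat n n" by (simp add: S_def replace_col_def)
  have detS: "det S = w $ i"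
    using cramer_lemma_mat[of "1\<^sub>m n" n w i] w ki by (simp add: S_def)
  have Sij: "S $$ (a, b) = (if b = i then w $ a else if a = b then 1 else 0)" if "a < n" "b < n" for a b
    using that by (simp add: S_def replace_col_def)
  define R where "R = (if k = i then S else swapcols k i S)"
  have R: "R \<in> carrier_mat n n" using S unfolding R_def mat_swapcols_def by auto
  have "det R \<noteq> 0" using detS w det_swapcols[of k n i S] S ki by (auto simp: R_def)
  hence "R \<in> GL_mat n" using R by (simp add: GL_mat_def)
  moreover have "col R j = unit_vec n j" if "j < k" for j
    by (rule eq_vecI) (use that ki S R in \<open>auto simp: R_def Sij unit_vec_def\<close>)
  moreover have "col R k = w"
    by (rule eq_vecI) (use ki S R w in \<open>auto simp: R_def Sij\<close>)
  ultimately show ?thesis using that by blast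
qed

text \<open>The first k Krylov vectors are the first k unit vectors. The sequence cannot be
  prolonged exactly when the next vector lies in their span, that is, when its coordinates from k on
  vanish.\<close>

lemma krylov_bases_Suc_empty_iff:
  assumes A: "A \<in> carrier_mat n n" and u: "u \<in> carrier_vec n"
    and one: "1\<^sub>m n \<in> krylov_bases n A u k"
  shows "krylov_bases n A u (Suc k) = {} \<longleftrightarrow> (\<forall>i. k \<le> i \<longrightarrow> i < n \<longrightarrow> (A ^\<^sub>m k *\<^sub>v u) $ i = 0)"
    (is "?L \<longleftrightarrow> ?R")
proof
  have kn: "k \<le> n" and uj: "\<And>j. j < k \<Longrightarrow> A ^\<^sub>m j *\<^sub>v u = unit_vec n j"
    using one by (auto simp: krylov_bases_def)
  define w where "w = A ^\<^sub>m k *\<^sub>v u"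
  have w: "w \<in> carrier_vec n" unfolding w_def using A u by (intro mult_mat_vec_carrier[of _ n n]) auto
  show ?R if L: ?L
  proof (rule ccontr)
    assume "\<not> ?R"
    then obtain i where i: "k \<le> i" "i < n" "w $ i \<noteq> 0" unfolding w_def by auto
    from GL_mat_with_prescribed_column[OF w i(3) i(1,2)] obtain R where
      R: "R \<in> GL_mat n" "\<And>j. j < k \<Longrightarrow> col R j = unit_vec n j" "col R k = w" by blast
    have "R \<in> krylov_bases n A u (Suc k)"
      using R i uj by (auto simp: krylov_bases_def less_Suc_eq w_def)
    thus False using L by auto
  qed
  show ?L if R: ?R
  proof (rule ccontr)
    assume "\<not> ?L"
    then obtain P where P: "P \<in> krylov_bases n A u (Suc k)" by auto
    hence PG: "P \<in> GL_mat n" and k: "k < n" by (auto simp: krylov_bases_def)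
    have Pc: "P \<in> carrier_mat n n" using PG by (simp add: GL_mat_def)
    have cP: "col P j = A ^\<^sub>m j *\<^sub>v u" if "j \<le> k" for j using P that by (auto simp: krylov_bases_def)
    \<comment> \<open>The vector w is supported on coordinates below k, where the columns of P are
      unit vectors. Column k of P is w as well, so P w = P e_k; invertibility then gives w = e_k,
      contradicting w_k = 0.\<close>
    have "P *\<^sub>v w = w"
    proof (rule eq_vecI)
      fix a assume a: "a < dim_vec w"
      have "(P *\<^sub>v w) $ a = (\<Sum>b = 0..<n. P $$ (a, b) * w $ b)"
        using a w Pc by (auto simp: scalar_prod_def)
      also have "\<dots> = (\<Sum>b = 0..<n. if b = a then w $ b else 0)"
      proof (rule sum.cong)
        fix b assume b: "b \<in> {0..<n}"
        show "P $$ (a, b) * w $ b = (if b = a then w $ b else 0)"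
        proof (cases "b < k")
          case True
          have "P $$ (a, b) = col P b $ a" using a w Pc b by simp
          also have "\<dots> = unit_vec n b $ a" using cP[of b] uj[OF True] True by simp
          finally show ?thesis using a w b by simp
        next
          case False
          thus ?thesis using R b unfolding w_def by simp
        qed
      qed simp
      also have "\<dots> = w $ a" using a w by simp
      finally show "(P *\<^sub>v w) $ a = w $ a" .
    qed (use w Pc in auto)
    hence eq: "P *\<^sub>v w = P *\<^sub>v unit_vec n k"
      using cP[of k] mult_mat_unit_vec[OF Pc k] by (simp add: w_def)
    obtain Q where Q: "Q \<in> GL_mat n" "Q * P = 1\<^sub>m n" using GL_mat_obtain_inverse[OF PG] by metis
    have Qc: "Q \<in> carrier_mat n n" using Q by (simp add: GL_mat_def)
    have cancel: "Q *\<^sub>v (P *\<^sub>v x) = x" if "x \<in> carrier_vec n" for x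
      using assoc_mult_mat_vec[OF Qc Pc that] Q that by auto
    have "w = unit_vec n k"
      using cancel[OF w] cancel[OF unit_vec_carrier[of n k]] unfolding eq by metis
    hence "w $ k = 1" using k by simp
    thus False using R k unfolding w_def by simp
  qed
qed

lemma krylov_bases_antimono: "j \<le> k \<Longrightarrow> krylov_bases n M v k \<subseteq> krylov_bases n M v j"
  by (auto simp: krylov_bases_def)

lemma krylov_bases_0: "krylov_bases n M v 0 = GL_mat n"
  by (simp add: krylov_bases_def)

section \<open>Block normal form of a pair for which the standard basis is a Krylov basis\<close>

lemma four_block_mat_inject:
  assumes "A \<in> carrier_mat n n" "A' \<in> carrier_mat n n" "B \<in> carrier_mat n m" "B' \<in> carrier_mat n m"
    "D \<in> carrier_mat m m" "D' \<in> carrier_mat m m"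
    and eq: "four_block_mat A B C D = four_block_mat A' B' C' D'"
  shows "A = A'" "B = B'" "D = D'"
proof -
  have e: "four_block_mat A B C D $$ (i, j) = four_block_mat A' B' C' D' $$ (i, j)" for i j
    using eq by simp
  show "A = A'"
  proof (rule eq_matI)
    fix i j assume "i < dim_row A'" "j < dim_col A'"
    thus "A $$ (i, j) = A' $$ (i, j)" using assms(1-6) e[of i j] by simp
  qed (use assms in auto)
  show "B = B'"
  proof (rule eq_matI)
    fix i j assume "i < dim_row B'" "j < dim_col B'"
    thus "B $$ (i, j) = B' $$ (i, j)" using assms(1-6) e[of i "j + n"] by simp
  qed (use assms in auto)
  show "D = D'"
  proof (rule eq_matI)
    fix i j assume "i < dim_row D'" "j < dim_col D'"
    thus "D $$ (i, j) = D' $$ (i, j)" using assms(1-6) e[of "i + n" "j + n"] by simp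
  qed (use assms in auto)
qed

lemma companion_mat_inject:
  assumes "monic e" "monic e'" "degree e = degree e'" and eq: "companion_mat e = companion_mat e'"
  shows "e = e'"
proof (rule poly_eqI)
  fix i
  define k where "k = degree e"
  consider "i < k" | "i = k" | "i > k" by linarith
  thus "coeff e i = coeff e' i"
  proof cases
    case 1
    hence "companion_mat e $$ (i, k - 1) = - coeff e i" "companion_mat e' $$ (i, k - 1) = - coeff e' i"
      using assms(3) by (auto simp: companion_mat_def k_def)
    thus ?thesis using eq by simp
  qed (use assms in \<open>auto simp: k_def coeff_eq_0\<close>)
qed

text \<open>Since \<open>A ^ 0 u = u\<close>, the vector \<open>u\<close> has to vanish when \<open>k = 0\<close>.\<close>
definition krylov_normal_form :: "nat \<Rightarrow> nat \<Rightarrow> 'a :: field poly \<times> 'a mat \<times> 'a mat \<Rightarrow> 'a mat \<times> 'a vec" where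
  "krylov_normal_form k m = (\<lambda>(e, B, D).
     (four_block_mat (companion_mat e) B (0\<^sub>m m k) D, if k = 0 then 0\<^sub>v (k + m) else unit_vec (k + m) 0))"

lemma inj_on_krylov_normal_form:
  "inj_on (krylov_normal_form k m) ({e. monic e \<and> degree e = k} \<times> carrier_mat k m \<times> carrier_mat m m)"
proof (rule inj_onI)
  fix x y :: "'a poly \<times> 'a mat \<times> 'a mat"
  assume xy: "x \<in> {e. monic e \<and> degree e = k} \<times> carrier_mat k m \<times> carrier_mat m m"
    "y \<in> {e. monic e \<and> degree e = k} \<times> carrier_mat k m \<times> carrier_mat m m"
    and eq: "krylov_normal_form k m x = krylov_normal_form k m y"
  obtain e B D e' B' D' where x: "x = (e, B, D)" and y: "y = (e', B', D')" by (metis prod.collapse)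
  have *: "monic e" "monic e'" "degree e = k" "degree e' = k"
    "B \<in> carrier_mat k m" "B' \<in> carrier_mat k m" "D \<in> carrier_mat m m" "D' \<in> carrier_mat m m"
    using xy by (auto simp: x y)
  have "companion_mat e \<in> carrier_mat k k" "companion_mat e' \<in> carrier_mat k k"
    using companion_mat_carrier[of e] companion_mat_carrier[of e'] *(3,4) by simp_all
  from four_block_mat_inject[OF this *(5-8)] eq
  have "companion_mat e = companion_mat e'" "B = B'" "D = D'"
    by (auto simp: krylov_normal_form_def x y)
  thus "x = y" using companion_mat_inject[of e e'] * by (simp add: x y)
qed

text \<open>If the standard basis is a Krylov basis of maximal length k, then A shifts e_0, ...,
  e_(k-2) and sends e_(k-1) to A^k u, which maximality puts in the span of the first k unit vectors.
  So the first k columns are a companion block above zeros, while the last m columns are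
  arbitrary.\<close>

lemma krylov_normal_form_range:
  "krylov_normal_form k m ` ({e. monic e \<and> degree e = k} \<times> carrier_mat k m \<times> carrier_mat m m) =
   {(A, u). A \<in> carrier_mat (k + m) (k + m) \<and> u \<in> carrier_vec (k + m) \<and>
     1\<^sub>m (k + m) \<in> krylov_bases (k + m) A u k \<and> krylov_bases (k + m) A u (Suc k) = {}}" (is "?L = ?R")
proof (intro equalityI subsetI)
  fix x :: "'a mat \<times> 'a vec" assume "x \<in> ?L"
  then obtain e B D where e: "monic e" "degree e = k" and B: "B \<in> carrier_mat k m" and D: "D \<in> carrier_mat m m"
    and x: "x = krylov_normal_form k m (e, B, D)" by auto
  define A where "A = four_block_mat (companion_mat e) B (0\<^sub>m m k) D"
  define u :: "'a vec" where "u = (if k = 0 then 0\<^sub>v (k + m) else unit_vec (k + m) 0)"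
  have C: "companion_mat e \<in> carrier_mat k k" using companion_mat_carrier[of e] e by simp
  have A: "A \<in> carrier_mat (k + m) (k + m)" unfolding A_def using C D by simp
  have u: "u \<in> carrier_vec (k + m)" by (simp add: u_def)
  have Aij: "A $$ (i, j) = (if i < k then if Suc j = k then - coeff e i else if i = Suc j then 1 else 0 else 0)"
    if "i < k + m" "j < k" for i j
    using that C D e by (simp add: A_def companion_mat_def)
  have pow: "A ^\<^sub>m j *\<^sub>v u = unit_vec (k + m) j" if "j < k" for j
    using that
  proof (induction j)
    case 0
    thus ?case using A by (simp add: u_def)
  next
    case (Suc j)
    have "A ^\<^sub>m Suc j *\<^sub>v u = col A j"
      using Suc mult_mat_unit_vec[OF A, of j] unfolding Suc_pow_mat_mult_vec[OF A u] by simp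
    also have "\<dots> = unit_vec (k + m) (Suc j)"
      using Suc.prems A by (intro eq_vecI) (auto simp: Aij)
    finally show ?case .
  qed
  have one: "1\<^sub>m (k + m) \<in> krylov_bases (k + m) A u k"
    using pow by (simp add: krylov_bases_def one_GL_mat)
  moreover have "(A ^\<^sub>m k *\<^sub>v u) $ i = 0" if "k \<le> i" "i < k + m" for i
  proof (cases k)
    case 0
    thus ?thesis using that A by (simp add: u_def)
  next
    case (Suc j)
    have "A ^\<^sub>m k *\<^sub>v u = col A j"
      using Suc mult_mat_unit_vec[OF A, of j] pow[of j] Suc_pow_mat_mult_vec[OF A u, of j] by simp
    thus ?thesis using that A Suc by (simp add: Aij)
  qed
  hence "krylov_bases (k + m) A u (Suc k) = {}"
    using krylov_bases_Suc_empty_iff[OF A u one] by blast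
  ultimately have "(A, u) \<in> ?R" using A u by simp
  thus "x \<in> ?R" unfolding x krylov_normal_form_def A_def u_def by simp
next
  fix x :: "'a mat \<times> 'a vec" assume "x \<in> ?R"
  then obtain A u where x: "x = (A, u)" and A: "A \<in> carrier_mat (k + m) (k + m)" and u: "u \<in> carrier_vec (k + m)"
    and one: "1\<^sub>m (k + m) \<in> krylov_bases (k + m) A u k" and emp: "krylov_bases (k + m) A u (Suc k) = {}" by auto
  define w where "w = A ^\<^sub>m k *\<^sub>v u"
  have w: "w \<in> carrier_vec (k + m)" unfolding w_def using A u
    by (intro mult_mat_vec_carrier[of _ "k + m" "k + m"]) auto
  have w0: "w $ i = 0" if "k \<le> i" "i < k + m" for i
    using krylov_bases_Suc_empty_iff[OF A u one] emp that unfolding w_def by blast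
  have pow: "A ^\<^sub>m j *\<^sub>v u = unit_vec (k + m) j" if "j < k" for j
    using one that by (auto simp: krylov_bases_def)
  have colA: "col A j = (if Suc j = k then w else unit_vec (k + m) (Suc j))" if "j < k" for j
  proof -
    have "A ^\<^sub>m Suc j *\<^sub>v u = col A j"
      unfolding Suc_pow_mat_mult_vec[OF A u] pow[OF that] using that A by (intro mult_mat_unit_vec) auto
    thus ?thesis using pow[of "Suc j"] that by (auto simp: w_def)
  qed
  have Aij: "A $$ (i, j) = (if Suc j = k then w $ i else if i = Suc j then 1 else 0)"
    if "i < k + m" "j < k" for i j
    using colA[OF that(2)] that A index_col[of i A j] by (auto simp del: index_col)
  \<comment> \<open>The coefficients come from the relation A^k u = sum of w_i A^i u, so that the
    last column of the companion matrix of e consists of the first k entries of w.\<close>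
  define e where "e = monom 1 k - (\<Sum>i<k. monom (w $ i) i)"
  have ce: "coeff e i = (if i = k then 1 else if i < k then - (w $ i) else 0)" for i
    by (auto simp: e_def coeff_sum)
  have deg: "degree e = k" by (intro antisym degree_le le_degree) (auto simp: ce)
  have mon: "monic e" by (simp add: deg ce)
  define B where "B = mat k m (\<lambda>(i, j). A $$ (i, j + k))"
  define D where "D = mat m m (\<lambda>(i, j). A $$ (i + k, j + k))"
  have "A = four_block_mat (companion_mat e) B (0\<^sub>m m k) D"
    using A by (intro eq_matI) (auto simp: companion_mat_def deg B_def D_def ce Aij w0)
  moreover have "u = (if k = 0 then 0\<^sub>v (k + m) else unit_vec (k + m) 0)"
  proof (cases "k = 0")
    case True
    have "u = w" using True A u by (simp add: w_def)
    also have "w = 0\<^sub>v (k + m)" using True w w0 by (intro eq_vecI) auto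
    finally show ?thesis using True by simp
  next
    case False
    thus ?thesis using pow[of 0] A u by simp
  qed
  ultimately have "x = krylov_normal_form k m (e, B, D)" unfolding x krylov_normal_form_def by simp
  thus "x \<in> ?L" using deg mon by (auto simp: B_def D_def)
qed

section \<open>Counting matrices by characteristic polynomial\<close>

text \<open>Such a matrix is block upper triangular with identity block in the corner: the upper
  right block is free, and the determinant is that of the lower right block.\<close>

lemma card_GL_mat_fixing_unit_vecs:
  "card {U \<in> GL_mat (k + m) :: 'a :: {finite, field} mat set. \<forall>j<k. col U j = unit_vec (k + m) j} =
     CARD('a) ^ (k * m) * card (GL_mat m :: 'a mat set)"
proof -
  let ?f = "\<lambda>(X :: 'a mat, Y). four_block_mat (1\<^sub>m k) X (0\<^sub>m m k) Y"
  have img: "{U \<in> GL_mat (k + m). \<forall>j<k. col U j = unit_vec (k + m) j} = ?f ` (carrier_mat k m \<times> GL_mat m)"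
  proof (intro equalityI subsetI)
    fix U :: "'a mat" assume "U \<in> {U \<in> GL_mat (k + m). \<forall>j<k. col U j = unit_vec (k + m) j}"
    hence U: "U \<in> carrier_mat (k + m) (k + m)" "det U \<noteq> 0"
      and col: "\<And>j. j < k \<Longrightarrow> col U j = unit_vec (k + m) j" by (auto simp: GL_mat_def)
    have Uij: "U $$ (i, j) = (if i = j then 1 else 0)" if "i < k + m" "j < k" for i j
      using col[OF that(2)] that U(1) index_col[of i U j] by (auto simp del: index_col)
    define X where "X = mat k m (\<lambda>(i, j). U $$ (i, j + k))"
    define Y where "Y = mat m m (\<lambda>(i, j). U $$ (i + k, j + k))"
    have X: "X \<in> carrier_mat k m" and Y: "Y \<in> carrier_mat m m" by (auto simp: X_def Y_def)
    have eq: "U = four_block_mat (1\<^sub>m k) X (0\<^sub>m m k) Y"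
      using U(1) by (intro eq_matI) (auto simp: X_def Y_def Uij)
    have "det U = det Y" unfolding eq
      using det_four_block_mat_lower_left_zero[OF one_carrier_mat X refl Y] by simp
    hence "Y \<in> GL_mat m" using U(2) Y by (simp add: GL_mat_def)
    with eq X show "U \<in> ?f ` (carrier_mat k m \<times> GL_mat m)"
      by (intro rev_image_eqI[of "(X, Y)"]) auto
  next
    fix U :: "'a mat" assume "U \<in> ?f ` (carrier_mat k m \<times> GL_mat m)"
    then obtain X Y where X: "X \<in> carrier_mat k m" and Y: "Y \<in> carrier_mat m m" "det Y \<noteq> 0"
      and U: "U = four_block_mat (1\<^sub>m k) X (0\<^sub>m m k) Y" by (auto simp: GL_mat_def)
    have Uc: "U \<in> carrier_mat (k + m) (k + m)" using Y by (simp add: U)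
    have "det U = det Y" unfolding U
      using det_four_block_mat_lower_left_zero[OF one_carrier_mat X refl Y(1)] by simp
    moreover have "col U j = unit_vec (k + m) j" if "j < k" for j
      using that Y(1) by (intro eq_vecI) (auto simp: U)
    ultimately show "U \<in> {U \<in> GL_mat (k + m). \<forall>j<k. col U j = unit_vec (k + m) j}"
      using Uc Y by (simp add: GL_mat_def)
  qed
  have inj: "inj_on ?f (carrier_mat k m \<times> GL_mat m)"
  proof (rule inj_onI)
    fix p q :: "'a mat \<times> 'a mat"
    assume *: "p \<in> carrier_mat k m \<times> GL_mat m" "q \<in> carrier_mat k m \<times> GL_mat m" "?f p = ?f q"
    obtain X Y X' Y' where pq: "p = (X, Y)" "q = (X', Y')" by (metis prod.collapse)
    show "p = q"
      using four_block_mat_inject[of "1\<^sub>m k" k "1\<^sub>m k" X m X' Y Y' "0\<^sub>m m k" "0\<^sub>m m k"] *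
      by (auto simp: pq GL_mat_def)
  qed
  show ?thesis unfolding img card_image[OF inj]
    by (simp add: card_cartesian_product card_carrier_mat)
qed

text \<open>Two Krylov bases of the same pair differ by right multiplication with an invertible
  matrix fixing the first k unit vectors. The set is therefore a coset of that stabilizer, and its
  size does not depend on the pair.\<close>

lemma card_krylov_bases:
  fixes M :: "'a :: {finite, field} mat"
  assumes M: "M \<in> carrier_mat (k + m) (k + m)" and v: "v \<in> carrier_vec (k + m)"
    and ne: "krylov_bases (k + m) M v k \<noteq> {}"
  shows "card (krylov_bases (k + m) M v k) =
    CARD('a) ^ (k * m) * card (GL_mat m :: 'a mat set)"
proof -
  let ?n = "k + m"
  let ?S = "{U \<in> GL_mat ?n. \<forall>j<k. col U j = unit_vec ?n j}"
  obtain P where P: "P \<in> krylov_bases ?n M v k" using ne by auto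
  have PG: "P \<in> GL_mat ?n" and colP: "\<And>j. j < k \<Longrightarrow> col P j = M ^\<^sub>m j *\<^sub>v v"
    using P by (auto simp: krylov_bases_def)
  have Pc: "P \<in> carrier_mat ?n ?n" using PG by (simp add: GL_mat_def)
  obtain Q where Q: "Q \<in> GL_mat ?n" and PQ: "P * Q = 1\<^sub>m ?n" and QP: "Q * P = 1\<^sub>m ?n"
    using GL_mat_obtain_inverse[OF PG] by metis
  have Qc: "Q \<in> carrier_mat ?n ?n" using Q by (simp add: GL_mat_def)
  have PQX: "P * (Q * X) = X" if "X \<in> carrier_mat ?n ?n" for X
    using assoc_mult_mat[OF Pc Qc that] PQ that by simp
  have QPX: "Q * (P * X) = X" if "X \<in> carrier_mat ?n ?n" for X
    using assoc_mult_mat[OF Qc Pc that] QP that by simp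
  have mult_mem: "P * U \<in> krylov_bases ?n M v k" if "U \<in> ?S" for U
  proof -
    have U: "U \<in> GL_mat ?n" "U \<in> carrier_mat ?n ?n" "\<And>j. j < k \<Longrightarrow> col U j = unit_vec ?n j"
      using that by (auto simp: GL_mat_def)
    have "col (P * U) j = M ^\<^sub>m j *\<^sub>v v" if "j < k" for j
      using that colP[OF that] U(3)[OF that] mult_mat_unit_vec[OF Pc, of j] col_mult2[OF Pc U(2), of j] by simp
    thus ?thesis using GL_mat_mult[OF PG U(1)] by (simp add: krylov_bases_def)
  qed
  have mult_inv_mem: "Q * R \<in> ?S" if "R \<in> krylov_bases ?n M v k" for R
  proof -
    have R: "R \<in> GL_mat ?n" "R \<in> carrier_mat ?n ?n" "\<And>j. j < k \<Longrightarrow> col R j = col P j"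
      using that colP by (auto simp: GL_mat_def krylov_bases_def)
    have "col (Q * R) j = unit_vec ?n j" if "j < k" for j
    proof -
      have "col (Q * R) j = col (Q * P) j"
        using that R(3)[OF that] col_mult2[OF Qc R(2), of j] col_mult2[OF Qc Pc, of j] by simp
      thus ?thesis using that by (simp add: QP)
    qed
    thus ?thesis using GL_mat_mult[OF Q R(1)] by simp
  qed
  have "bij_betw (\<lambda>U. P * U) ?S (krylov_bases ?n M v k)"
  proof (rule bij_betw_byWitness[where f' = "\<lambda>R. Q * R"])
    show "\<forall>U\<in>?S. Q * (P * U) = U" using QPX by (auto simp: GL_mat_def)
    show "\<forall>R\<in>krylov_bases ?n M v k. P * (Q * R) = R" using PQX by (auto simp: GL_mat_def krylov_bases_def)
  qed (use mult_mem mult_inv_mem in blast)+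
  from bij_betw_same_card[OF this] show ?thesis
    unfolding card_GL_mat_fixing_unit_vecs by simp
qed

text \<open>The last two conditions together say that the cyclic subspace generated by v has
  dimension exactly k.\<close>

definition krylov_pairs :: "'a :: field poly set \<Rightarrow> nat \<Rightarrow> nat \<Rightarrow> ('a mat \<times> 'a vec) set" where
  "krylov_pairs J n k = {(M, v). M \<in> carrier_mat n n \<and> v \<in> carrier_vec n \<and> char_poly M \<in> J \<and>
     krylov_bases n M v k \<noteq> {} \<and> krylov_bases n M v (Suc k) = {}}"

lemma finite_krylov_pairs: "finite (krylov_pairs J n k :: ('a :: {finite, field} mat \<times> 'a vec) set)"
  by (rule finite_subset[of _ "carrier_mat n n \<times> carrier_vec n"])
    (auto simp: krylov_pairs_def card_carrier_mat card_carrier_vec)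

text \<open>For each matrix M the q^n vectors are partitioned by the dimension of the cyclic
  subspace they generate.\<close>

lemma card_krylov_pairs:
  fixes J :: "'a :: {finite, field} poly set"
  shows "CARD('a) ^ n * card {M \<in> carrier_mat n n. char_poly M \<in> J} = (\<Sum>k\<le>n. card (krylov_pairs J n k))"
proof -
  have "{M \<in> carrier_mat n n. char_poly M \<in> J} \<times> (carrier_vec n :: 'a vec set) = (\<Union>k\<le>n. krylov_pairs J n k)"
  proof (intro equalityI subsetI)
    fix x assume "x \<in> {M \<in> carrier_mat n n. char_poly M \<in> J} \<times> (carrier_vec n :: 'a vec set)"
    then obtain M v where x: "x = (M, v)" "M \<in> carrier_mat n n" "char_poly M \<in> J" "v \<in> carrier_vec n"
      by auto
    \<comment> \<open>The least index at which prolongation fails exists because no Krylov basis has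
      length n + 1. Minimality makes the set at k itself nonempty.\<close>
    define k where "k = (LEAST k. krylov_bases n M v (Suc k) = {})"
    have n: "krylov_bases n M v (Suc n) = {}" by (auto simp: krylov_bases_def)
    have "krylov_bases n M v (Suc k) = {}" unfolding k_def by (rule LeastI[of "\<lambda>k. krylov_bases n M v (Suc k) = {}", OF n])
    moreover have "k \<le> n" unfolding k_def by (rule Least_le[of "\<lambda>k. krylov_bases n M v (Suc k) = {}", OF n])
    moreover have "krylov_bases n M v k \<noteq> {}"
    proof (cases k)
      case 0
      thus ?thesis using one_GL_mat[of n] by (auto simp: krylov_bases_0)
    next
      case (Suc j)
      thus ?thesis using not_less_Least[of j "\<lambda>k. krylov_bases n M v (Suc k) = {}"] by (simp add: k_def)
    qed
    ultimately show "x \<in> (\<Union>k\<le>n. krylov_pairs J n k)" using x by (auto simp: krylov_pairs_def)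
  qed (auto simp: krylov_pairs_def)
  moreover have "krylov_pairs J n i \<inter> krylov_pairs J n j = {}" if "i < j" for i j
    using krylov_bases_antimono[of "Suc i" j n] that by (fastforce simp: krylov_pairs_def)
  hence "krylov_pairs J n i \<inter> krylov_pairs J n j = {}" if "i \<noteq> j" for i j
    using that by (metis Int_commute nat_neq_iff)
  hence "card (\<Union>k\<le>n. krylov_pairs J n k) = (\<Sum>k\<le>n. card (krylov_pairs J n k))"
    by (intro card_UN_disjoint) (auto simp: finite_krylov_pairs)
  ultimately show ?thesis
    using card_cartesian_product[of "{M \<in> carrier_mat n n. char_poly M \<in> J}" "carrier_vec n :: 'a vec set"]
    by (simp add: card_carrier_vec)
qed

text \<open>Count the triples \<open>(M, v, P)\<close> with \<open>P\<close> a Krylov basis of maximal length \<open>k\<close> for \<open>(M, v)\<close>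
  once through \<open>(M, v)\<close>, and once through \<open>P\<close> and the block form of \<open>P\<^sup>-\<^sup>1 M P\<close>.\<close>
lemma card_krylov_pairs_eq:
  fixes J :: "'a :: {finite, field} poly set"
  shows "card (krylov_pairs J (k + m) k) * card (GL_mat m :: 'a mat set) =
    card (GL_mat (k + m) :: 'a mat set) *
      card {(D, e). D \<in> carrier_mat m m \<and> monic e \<and> degree e = k \<and> e * char_poly D \<in> J}"
proof -
  let ?n = "k + m"
  let ?G = "GL_mat ?n :: 'a mat set"
  let ?K = "\<lambda>(M, v). krylov_bases ?n M v k"
  let ?X = "krylov_pairs J ?n k"
  \<comment> \<open>These are the pairs for which the standard basis itself is a Krylov basis of
    maximal length k. A triple (M, v, P) corresponds to P together with the pair of this kind
    obtained by conjugating with the inverse of P.\<close>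
  define Y where "Y = {(A, u). A \<in> carrier_mat ?n ?n \<and> u \<in> carrier_vec ?n \<and> char_poly A \<in> J \<and>
     1\<^sub>m ?n \<in> krylov_bases ?n A u k \<and> krylov_bases ?n A u (Suc k) = {}}"
  have "\<exists>I. \<forall>P\<in>?G. I P \<in> ?G \<and> P * I P = 1\<^sub>m ?n \<and> I P * P = 1\<^sub>m ?n"
    by (rule bchoice) (metis GL_mat_obtain_inverse)
  then obtain I where I: "\<And>P. P \<in> ?G \<Longrightarrow> I P \<in> ?G \<and> P * I P = 1\<^sub>m ?n \<and> I P * P = 1\<^sub>m ?n" by metis
  have Gc: "P \<in> carrier_mat ?n ?n" if "P \<in> ?G" for P using that by (simp add: GL_mat_def)
  have conj_inv: "Q * (P * A * Q) * P = A" "Q *\<^sub>v (P *\<^sub>v u) = u"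
    if "P \<in> ?G" "Q \<in> ?G" "Q * P = 1\<^sub>m ?n" "A \<in> carrier_mat ?n ?n" "u \<in> carrier_vec ?n" for P Q A u
  proof -
    note c = Gc[OF that(1)] Gc[OF that(2)] that(4,5)
    have "Q * (P * A * Q) * P = (Q * P) * A * (Q * P)"
      using c by (simp add: assoc_mult_mat[of _ ?n ?n _ ?n _ ?n])
    thus "Q * (P * A * Q) * P = A" using c that(3) by simp
    show "Q *\<^sub>v (P *\<^sub>v u) = u"
      using assoc_mult_mat_vec[OF c(2) c(1) c(4)] that(3) c by simp
  qed
  have char_conj: "char_poly (P * A * Q) = char_poly A"
    if "P \<in> ?G" "Q \<in> ?G" "P * Q = 1\<^sub>m ?n" "Q * P = 1\<^sub>m ?n" "A \<in> carrier_mat ?n ?n" for P Q A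
    by (rule char_poly_similar, rule similar_matI[of _ _ P Q ?n]) (use that Gc[OF that(1)] Gc[OF that(2)] in auto)
  have one_iff: "Q * R \<in> krylov_bases ?n A u j \<longleftrightarrow> R \<in> krylov_bases ?n (P * A * Q) (P *\<^sub>v u) j"
    if "P \<in> ?G" "Q \<in> ?G" "P * Q = 1\<^sub>m ?n" "Q * P = 1\<^sub>m ?n" "A \<in> carrier_mat ?n ?n" "u \<in> carrier_vec ?n"
      "R \<in> carrier_mat ?n ?n" for P Q A u R j
    using krylov_bases_conj[OF that(5,6,1,2,3,4,7)] by simp
  have empty_conj: "krylov_bases ?n (P * A * Q) (P *\<^sub>v u) j = {}"
    if "P \<in> ?G" "Q \<in> ?G" "P * Q = 1\<^sub>m ?n" "Q * P = 1\<^sub>m ?n" "A \<in> carrier_mat ?n ?n" "u \<in> carrier_vec ?n"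
      "krylov_bases ?n A u j = {}" for P Q A u j
  proof (rule ccontr)
    assume "krylov_bases ?n (P * A * Q) (P *\<^sub>v u) j \<noteq> {}"
    then obtain R where R: "R \<in> krylov_bases ?n (P * A * Q) (P *\<^sub>v u) j" by auto
    hence "R \<in> carrier_mat ?n ?n" by (simp add: krylov_bases_def GL_mat_def)
    from one_iff[OF that(1-6) this] R that(7) show False by blast
  qed
  let ?f = "\<lambda>(P, (A, u)). ((P * A * I P, P *\<^sub>v u), P)"
  let ?g = "\<lambda>((M, v), P). (P, (I P * M * P, I P *\<^sub>v v))"
  have "bij_betw ?f (?G \<times> Y) (SIGMA x:?X. ?K x)"
  proof (rule bij_betw_byWitness[where f' = ?g])
    show "\<forall>y\<in>?G \<times> Y. ?g (?f y) = y"
      using conj_inv I by (auto simp: Y_def)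
    show "\<forall>z\<in>(SIGMA x:?X. ?K x). ?f (?g z) = z"
    proof
      fix z assume z: "z \<in> (SIGMA x:?X. ?K x)"
      obtain M v P where zz: "z = ((M, v), P)" by (metis prod.collapse)
      have "P \<in> ?G" "M \<in> carrier_mat ?n ?n" "v \<in> carrier_vec ?n"
        using z by (auto simp: zz krylov_pairs_def krylov_bases_def)
      thus "?f (?g z) = z" using I[of P] conj_inv[of "I P" P M v] by (simp add: zz)
    qed
    show "?f ` (?G \<times> Y) \<subseteq> (SIGMA x:?X. ?K x)"
    proof (rule image_subsetI)
      fix y assume y: "y \<in> ?G \<times> Y"
      obtain P A u where yy: "y = (P, (A, u))" by (metis prod.collapse)
      have P: "P \<in> ?G" and A: "A \<in> carrier_mat ?n ?n" and u: "u \<in> carrier_vec ?n" and J: "char_poly A \<in> J"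
        and one: "1\<^sub>m ?n \<in> krylov_bases ?n A u k" and emp: "krylov_bases ?n A u (Suc k) = {}"
        using y by (auto simp: yy Y_def)
      have Q: "I P \<in> ?G" "P * I P = 1\<^sub>m ?n" "I P * P = 1\<^sub>m ?n" using I[OF P] by auto
      have "P \<in> krylov_bases ?n (P * A * I P) (P *\<^sub>v u) k"
        using one_iff[OF P Q A u Gc[OF P], of k] one Q by simp
      thus "?f y \<in> (SIGMA x:?X. ?K x)"
        using char_conj[OF P Q A] empty_conj[OF P Q A u emp] J Gc[OF P] Gc[OF Q(1)] A u
        by (auto simp: yy krylov_pairs_def)
    qed
    show "?g ` (SIGMA x:?X. ?K x) \<subseteq> ?G \<times> Y"
    proof (rule image_subsetI)
      fix z assume z: "z \<in> (SIGMA x:?X. ?K x)"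
      obtain M v P where zz: "z = ((M, v), P)" by (metis prod.collapse)
      have M: "M \<in> carrier_mat ?n ?n" and v: "v \<in> carrier_vec ?n" and J: "char_poly M \<in> J"
        and PK: "P \<in> krylov_bases ?n M v k" and emp: "krylov_bases ?n M v (Suc k) = {}"
        using z by (auto simp: zz krylov_pairs_def)
      have P: "P \<in> ?G" using PK by (simp add: krylov_bases_def)
      have Q: "I P \<in> ?G" "I P * P = 1\<^sub>m ?n" "P * I P = 1\<^sub>m ?n" using I[OF P] by auto
      have "1\<^sub>m ?n \<in> krylov_bases ?n (I P * M * P) (I P *\<^sub>v v) k"
        using one_iff[OF Q(1) P Q(2,3) M v one_carrier_mat, of k] PK Gc[OF P] by simp
      thus "?g z \<in> ?G \<times> Y"
        using char_conj[OF Q(1) P Q(2,3) M] empty_conj[OF Q(1) P Q(2,3) M v emp] J Gc[OF P] Gc[OF Q(1)] M v P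
        by (auto simp: zz Y_def)
    qed
  qed
  hence "card (?G \<times> Y) = card (SIGMA x:?X. ?K x)" by (rule bij_betw_same_card)
  also have "\<dots> = (\<Sum>x\<in>?X. card (?K x))"
    by (intro card_SigmaI finite_krylov_pairs)
      (auto simp: krylov_bases_def intro: finite_subset[OF _ finite_GL_mat[of ?n]])
  also have "\<dots> = (\<Sum>x\<in>?X. CARD('a) ^ (k * m) * card (GL_mat m :: 'a mat set))"
    by (intro sum.cong refl) (auto simp: krylov_pairs_def intro!: card_krylov_bases)
  finally have 1: "card ?G * card Y = card ?X * (CARD('a) ^ (k * m) * card (GL_mat m :: 'a mat set))"
    by (simp add: card_cartesian_product)

  \<comment> \<open>\<open>Y\<close> is now counted through its normal form. The block B does not
    enter the characteristic polynomial, so it ranges freely and contributes q^(k m).\<close>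
  let ?T = "{(D, e). D \<in> carrier_mat m m \<and> monic e \<and> degree e = k \<and> e * char_poly D \<in> J}"
  let ?E = "{e :: 'a poly. monic e \<and> degree e = k} \<times> carrier_mat k m \<times> carrier_mat m m"
  let ?h = "\<lambda>(B, (D, e)). krylov_normal_form k m (e, B, D)"
  have char_nf: "char_poly (fst (krylov_normal_form k m (e, B, D))) = e * char_poly D"
    if "(e, B, D) \<in> ?E" for e :: "'a poly" and B D
    using that char_poly_four_block_lower_left_zero[of "companion_mat e" k B m D]
      char_poly_companion_mat[of e] companion_mat_carrier[of e]
    by (auto simp: krylov_normal_form_def simp del: companion_mat_carrier)
  have "Y = {x \<in> krylov_normal_form k m ` ?E. char_poly (fst x) \<in> J}"
    unfolding krylov_normal_form_range Y_def by auto
  also have "\<dots> = ?h ` (carrier_mat k m \<times> ?T)"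
  proof (intro equalityI subsetI)
    fix x assume "x \<in> {x \<in> krylov_normal_form k m ` ?E. char_poly (fst x) \<in> J}"
    then obtain e B D where "(e, B, D) \<in> ?E" "x = krylov_normal_form k m (e, B, D)" "char_poly (fst x) \<in> J"
      by auto
    thus "x \<in> ?h ` (carrier_mat k m \<times> ?T)"
      using char_nf[of e B D] by (intro rev_image_eqI[of "(B, (D, e))"]) auto
  next
    fix x assume "x \<in> ?h ` (carrier_mat k m \<times> ?T)"
    then obtain e B D where "(e, B, D) \<in> ?E" "x = krylov_normal_form k m (e, B, D)" "e * char_poly D \<in> J"
      by auto
    thus "x \<in> {x \<in> krylov_normal_form k m ` ?E. char_poly (fst x) \<in> J}"
      using char_nf[of e B D] by (metis (mono_tags, lifting) imageI mem_Collect_eq)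
  qed
  finally have Y: "Y = ?h ` (carrier_mat k m \<times> ?T)" .
  have "inj_on ?h (carrier_mat k m \<times> ?T)"
  proof (rule inj_onI)
    fix x y :: "'a mat \<times> 'a mat \<times> 'a poly"
    assume *: "x \<in> carrier_mat k m \<times> ?T" "y \<in> carrier_mat k m \<times> ?T" "?h x = ?h y"
    obtain B D e B' D' e' where xy: "x = (B, (D, e))" "y = (B', (D', e'))" by (metis prod.collapse)
    have "(e, B, D) = (e', B', D')"
      by (rule inj_onD[OF inj_on_krylov_normal_form[of k m]]) (use * in \<open>auto simp: xy\<close>)
    thus "x = y" by (simp add: xy)
  qed
  hence 2: "card Y = CARD('a) ^ (k * m) * card ?T"
    unfolding Y by (simp add: card_image card_cartesian_product card_carrier_mat)
  \<comment> \<open>The same power of q occurs on both sides, once from the Krylov bases of a pair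
    and once from the free block B, and is cancelled.\<close>
  have "CARD('a) ^ (k * m) > 0" by simp
  thus ?thesis using 1 unfolding 2 by (simp add: ac_simps)
qed

text \<open>Sum the previous count over all dimensions k, reindexed by the codimension m = n - k.
  The number of pairs (D, e) is split according to D.\<close>

lemma card_char_poly_in:
  fixes J :: "'a :: {finite, field} poly set"
  shows "real CARD('a) ^ n * real (card {M \<in> carrier_mat n n. char_poly M \<in> J}) =
    real (card (GL_mat n :: 'a mat set)) *
    (\<Sum>m\<le>n. (\<Sum>D\<in>carrier_mat m m. real (card {e. monic e \<and> degree e = n - m \<and> e * char_poly D \<in> J})) /
       real (card (GL_mat m :: 'a mat set)))"
proof -
  let ?s = "\<lambda>m. \<Sum>D\<in>carrier_mat m m. card {e. monic e \<and> degree e = n - m \<and> e * char_poly D \<in> J}"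
  have *: "real (card (krylov_pairs J n (n - m))) =
    real (card (GL_mat n :: 'a mat set)) * (real (?s m) / real (card (GL_mat m :: 'a mat set)))"
    if "m \<le> n" for m
  proof -
    let ?E = "\<lambda>D. {e. monic e \<and> degree e = n - m \<and> e * char_poly D \<in> J}"
    have "{(D, e). D \<in> carrier_mat m m \<and> monic e \<and> degree e = n - m \<and> e * char_poly D \<in> J} =
      (SIGMA D:carrier_mat m m. ?E D)" by auto
    also have "card \<dots> = ?s m"
      using card_carrier_mat(2)[where ?'a = 'a]
      by (intro card_SigmaI) (auto intro: finite_subset[OF _ finite_poly_degree_eq[of "n - m"]])
    finally have "card (krylov_pairs J n (n - m)) * card (GL_mat m :: 'a mat set) =
      card (GL_mat n :: 'a mat set) * ?s m"
      using card_krylov_pairs_eq[of J "n - m" m] that by simp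
    from arg_cong[OF this, of real, unfolded of_nat_mult]
    show ?thesis using card_GL_mat_pos[of m, where ?'a = 'a] by (simp add: field_simps)
  qed
  have "real CARD('a) ^ n * real (card {M \<in> carrier_mat n n. char_poly M \<in> J}) =
    (\<Sum>k\<le>n. real (card (krylov_pairs J n k)))"
    using arg_cong[OF card_krylov_pairs[of n J], of real] by simp
  also have "\<dots> = (\<Sum>m\<le>n. real (card (krylov_pairs J n (n - m))))"
    by (rule sum.reindex_bij_witness[of _ "\<lambda>m. n - m" "\<lambda>m. n - m"]) auto
  finally show ?thesis using * by (simp add: sum_distrib_left)
qed

section \<open>The determinant condition and the final estimate\<close>

lemma SL_mat_char_poly_in_I_int:
  "{M \<in> SL_mat n. char_poly M \<in> I_int f h} =
   {M \<in> carrier_mat n n. char_poly M \<in> {g \<in> I_int f h. coeff g 0 = (-1) ^ n}}"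
  by (auto simp: SL_mat_def coeff_0_char_poly)

text \<open>For singular D the product e * \<open>char_poly D\<close> vanishes at 0, so it cannot
  have constant coefficient c. Hence \<open>t m\<close> is the average over GL(m) of the number of
  cofactors, a number known exactly for m <= h and at most 1 beyond.\<close>

lemma sum_card_cofactors_char_poly:
  fixes f :: "'a :: {finite, field} poly"
  assumes f: "monic f" "h < degree f" and c: "c \<noteq> 0"
  defines "t \<equiv> \<lambda>m. (\<Sum>D\<in>carrier_mat m m. real (card {e. monic e \<and> degree e = degree f - m \<and>
      e * char_poly D \<in> {g \<in> I_int f h. coeff g 0 = c}})) / real (card (GL_mat m :: 'a mat set))"
  shows "m \<le> h \<Longrightarrow> t m = real CARD('a) ^ (h - m)"
    and "h < m \<Longrightarrow> 0 \<le> t m \<and> t m \<le> 1"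
proof -
  let ?e = "\<lambda>D. {e. monic e \<and> degree e = degree f - m \<and> e * char_poly D \<in> {g \<in> I_int f h. coeff g 0 = c}}"
  have cp: "degree (char_poly D) = m" "coeff (char_poly D) m = 1" if "D \<in> carrier_mat m m" for D :: "'a mat"
    using degree_monic_char_poly[OF that] by auto
  have GLc: "D \<in> carrier_mat m m" "coeff (char_poly D) 0 \<noteq> 0" if "D \<in> GL_mat m" for D :: "'a mat"
    using that by (auto simp: GL_mat_def coeff_0_char_poly)
  have singular: "?e D = {}" if "D \<in> carrier_mat m m - GL_mat m" for D :: "'a mat"
    using that c by (auto simp: GL_mat_def coeff_0_char_poly coeff_mult_0)
  have t: "t m = (\<Sum>D\<in>GL_mat m. real (card (?e D))) / real (card (GL_mat m :: 'a mat set))"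
  proof -
    have "(\<Sum>D\<in>carrier_mat m m. real (card (?e D))) = (\<Sum>D\<in>GL_mat m. real (card (?e D)))"
    proof (intro sum.mono_neutral_right card_carrier_mat(2) ballI)
      show "real (card (?e D)) = 0" if "D \<in> carrier_mat m m - GL_mat m" for D
        by (simp only: singular[OF that] card.empty of_nat_0)
    qed (auto simp: GL_mat_def)
    thus ?thesis unfolding t_def by simp
  qed
  have pos: "real (card (GL_mat m :: 'a mat set)) > 0" using card_GL_mat_pos[of m, where ?'a = 'a] by simp
  show "t m = real CARD('a) ^ (h - m)" if "m \<le> h"
  proof -
    have "real (card (?e D)) = real CARD('a) ^ (h - m)" if "D \<in> GL_mat m" for D
      using card_cofactors_eq[of "char_poly D" h f c] cp[OF GLc(1)[OF that]] GLc(2)[OF that] f \<open>m \<le> h\<close> by simp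
    thus ?thesis unfolding t using pos by simp
  qed
  show "0 \<le> t m \<and> t m \<le> 1" if "h < m"
  proof -
    have "real (card (?e D)) \<le> 1" if "D \<in> GL_mat m" for D
      using card_cofactors_le_1[of "char_poly D" h f c] cp[OF GLc(1)[OF that]] f \<open>h < m\<close> by simp
    hence "(\<Sum>D\<in>GL_mat m. real (card (?e D))) \<le> real (card (GL_mat m :: 'a mat set)) * 1"
      by (intro sum_bounded_above)
    thus ?thesis unfolding t using pos by (simp add: sum_nonneg)
  qed
qed

theorem theorem4p8:
  fixes f :: "'a :: {finite, field} poly" and n h :: nat
  assumes "n \<ge> 1" and "h < n" and "monic f" and "degree f = n"
  shows "abs (prob_SL_charpoly n f h - real (card (UNIV :: 'a set)) ^ (h + 1) / real (card (UNIV :: 'a set)) ^ n)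
           \<le> (real (card (UNIV :: 'a set)) - 1) * real (n - h) / real (card (UNIV :: 'a set)) ^ n"
proof -
  define q where "q = real CARD('a)"
  define J where "J = {g \<in> I_int f h. coeff g 0 = (-1) ^ n}"
  define N where "N = real (card {M \<in> SL_mat n. char_poly M \<in> I_int f h})"
  define t where "t = (\<lambda>m. (\<Sum>D\<in>carrier_mat m m. real (card {e. monic e \<and> degree e = n - m \<and>
      e * char_poly D \<in> J})) / real (card (GL_mat m :: 'a mat set)))"
  define r where "r = (\<Sum>m\<in>{h<..n}. t m)"
  have "card {0, 1 :: 'a} \<le> CARD('a)" by (rule card_mono) auto
  hence q: "q \<ge> 2" and q1: "real (CARD('a) - 1) = q - 1" by (auto simp: q_def)
  have f: "monic f" "h < degree f" using assms by auto
  have t_le: "t m = q ^ (h - m)" if "m \<le> h" for m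
    using sum_card_cofactors_char_poly(1)[OF f, of "(-1) ^ n" m] that assms by (simp add: t_def J_def q_def)
  have t_gt: "0 \<le> t m" "t m \<le> 1" if "h < m" for m
    using sum_card_cofactors_char_poly(2)[OF f, of "(-1) ^ n" m] that assms by (simp_all add: t_def J_def)
  have r0: "0 \<le> r" unfolding r_def using t_gt by (intro sum_nonneg) auto
  have r1: "r \<le> real (n - h)"
    using sum_bounded_above[of "{h<..n}" t 1] t_gt by (simp add: r_def)
  have "{..n} = {..h} \<union> {h<..n}" using assms by auto
  hence "(\<Sum>m\<le>n. t m) = (\<Sum>m\<le>h. t m) + r" unfolding r_def
    by (simp add: sum.union_disjoint ivl_disj_int)
  \<comment> \<open>Replacing m by h - m turns the exact terms into a geometric sum.\<close>
  also have "(\<Sum>m\<le>h. t m) = (\<Sum>m\<le>h. q ^ m)" using t_le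
    by (intro sum.reindex_bij_witness[of _ "\<lambda>m. h - m" "\<lambda>m. h - m"]) auto
  finally have sum_t: "(q - 1) * (\<Sum>m\<le>n. t m) = q ^ (h + 1) - 1 + (q - 1) * r"
    using power_diff_1_eq[of q "Suc h"] q by (simp add: algebra_simps lessThan_Suc_atMost)
  \<comment> \<open>The index q - 1 of SL(n) in GL(n) is precisely the denominator of the geometric
    sum, so the main term becomes q^(h+1) - 1.\<close>
  have G: "real (card (GL_mat n :: 'a mat set)) = (q - 1) * real (card (SL_mat n :: 'a mat set))"
    using card_GL_mat_SL_mat[OF assms(1), where ?'a = 'a] q1 by simp
  have Spos: "real (card (SL_mat n :: 'a mat set)) > 0"
    using card_GL_mat_pos[of n, where ?'a = 'a] card_GL_mat_SL_mat[OF assms(1), where ?'a = 'a] by simp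
  have "q ^ n * N = real (card (GL_mat n :: 'a mat set)) * (\<Sum>m\<le>n. t m)"
    using card_char_poly_in[of n J] unfolding N_def SL_mat_char_poly_in_I_int J_def[symmetric] t_def q_def .
  also have "\<dots> = real (card (SL_mat n :: 'a mat set)) * (q ^ (h + 1) - 1 + (q - 1) * r)"
    unfolding G sum_t[symmetric] by simp
  finally have "prob_SL_charpoly n f h = (q ^ (h + 1) - 1 + (q - 1) * r) / q ^ n"
    using Spos q unfolding prob_SL_charpoly_def N_def[symmetric] by (simp add: field_simps)
  \<comment> \<open>This is an exact formula for the error: the -1 is left over from the geometric
    sum, and r collects the terms with m > h.\<close>
  hence eq: "prob_SL_charpoly n f h - q ^ (h + 1) / q ^ n = ((q - 1) * r - 1) / q ^ n"
    by (simp add: diff_divide_distrib add_divide_distrib)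
  have "(q - 1) * r \<le> (q - 1) * real (n - h)" using q r1 by (intro mult_left_mono) auto
  \<comment> \<open>This covers the case where (q - 1) r - 1 is negative: its absolute value is then
    at most 1, which is below the bound since q >= 2 and n - h >= 1.\<close>
  moreover have "1 * 1 \<le> (q - 1) * real (n - h)" using q assms(2) by (intro mult_mono) auto
  moreover have "0 \<le> (q - 1) * r" using q r0 by simp
  ultimately have "\<bar>(q - 1) * r - 1\<bar> \<le> (q - 1) * real (n - h)" by linarith
  thus ?thesis unfolding q_def[symmetric] eq using q by (simp add: abs_divide divide_right_mono)
qed

end
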